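(* All outerplanar graphs are $(\frac{4}{2},2)$-colorable.
   Context: Graphs are finite, undirected and simple. An outerplanar graph is a graph with a planar drawing for which all vertices belong to the outer face of the drawing. For a positive integer $k$ and $i,j\in\{0,1,\dots,k-1\}$, the circular distance is $|i-j|_k=\min\{|i-j|,\,k-|i-j|\}$. For a nonnegative integer $d$, a $(\frac{k}{2},d)$-coloring ($d$-defective 2-distant circular $k$-coloring) of a graph $G$ is a mapping $f:V(G)\to\{0,1,\dots,k-1\}$ such that each vertex $v$ is adjacent to at most $d$ vertices $u$ with $|f(u)-f(v)|_k\le 1$ (adjacent vertices may receive the same color). $G$ is $(\frac{k}{2},d)$-colorable if it has such a coloring. (The symbol $\frac{k}{2}$ is formal notation recording the pair $(k,2)$, not a reduced fraction; so $\frac{4}{2}$ means $k=4$.) *)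

theory Defs
  imports "HOL-Analysis.Analysis"
begin

definition simple_graph :: "'a set \<Rightarrow> 'a set set \<Rightarrow> bool" where
  "simple_graph V E \<longleftrightarrow> finite V \<and> (\<forall>e\<in>E. e \<subseteq> V \<and> card e = 2)"

text \<open>
  The plane is taken to be \<^typ>\<open>complex\<close>. The map \<open>p\<close> places the vertices and \<open>\<gamma> e\<close> is a simple
  arc drawn for the edge \<open>e\<close>. Arcs may be arbitrary continuous curves. An arc meets the vertex set
  exactly in the two ends of its edge, and two distinct arcs meet only in vertices.
\<close>

definition planar_drawing ::
    "'a set \<Rightarrow> 'a set set \<Rightarrow> ('a \<Rightarrow> complex) \<Rightarrow> ('a set \<Rightarrow> real \<Rightarrow> complex) \<Rightarrow> bool" where
  "planar_drawing V E p \<gamma> \<longleftrightarrow>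
     inj_on p V \<and>
     (\<forall>e\<in>E. arc (\<gamma> e) \<and> {pathstart (\<gamma> e), pathfinish (\<gamma> e)} = p ` e \<and>
            path_image (\<gamma> e) \<inter> p ` V = p ` e) \<and>
     (\<forall>e\<in>E. \<forall>e'\<in>E. e \<noteq> e' \<longrightarrow> path_image (\<gamma> e) \<inter> path_image (\<gamma> e') \<subseteq> p ` V)"

definition drawing_points ::
    "'a set \<Rightarrow> 'a set set \<Rightarrow> ('a \<Rightarrow> complex) \<Rightarrow> ('a set \<Rightarrow> real \<Rightarrow> complex) \<Rightarrow> complex set" where
  "drawing_points V E p \<gamma> = p ` V \<union> (\<Union>e\<in>E. path_image (\<gamma> e))"

text \<open>
  The faces of a drawing with point set \<open>D\<close> are the components of the complement of \<open>D\<close>, and the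
  outer face is the unbounded one. For bounded \<open>D\<close> this is \<^term>\<open>outside D\<close>, by the lemma below.
  A vertex belongs to a face if it lies on the boundary of that face.
\<close>

lemma outer_face_eq_outside:
  fixes D :: "complex set"
  assumes "bounded D"
  shows "F \<in> components (- D) \<and> \<not> bounded F \<longleftrightarrow> F = outside D"
proof -
  have conn: "connected (outside D)"
    using assms by (intro connected_outside) simp_all
  have unb: "\<not> bounded (outside D)"
    using assms unbounded_outside by blast
  have comp: "connected_component_set (- D) x = outside D" if x: "x \<in> outside D" for x
  proof
    show "connected_component_set (- D) x \<subseteq> outside D"
      using outside_same_component x by fastforce
    show "outside D \<subseteq> connected_component_set (- D) x"
      using conn x outside_no_overlap[of D] by (intro connected_component_maximal) blast+
  qed
  show ?thesis
  proof
    assume F: "F \<in> components (- D) \<and> \<not> bounded F"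
    then obtain x where x: "x \<in> - D" "F = connected_component_set (- D) x"
      by (auto simp: components_def)
    with F have "x \<in> outside D" by (auto simp: outside_def)
    with comp x show "F = outside D" by simp
  next
    assume F: "F = outside D"
    have "outside D \<noteq> {}" using unb by auto
    then obtain x where x: "x \<in> outside D" by auto
    then have "x \<in> - D" using outside_no_overlap[of D] by blast
    then show "F \<in> components (- D) \<and> \<not> bounded F"
      using comp[OF x] F unb by (auto simp: components_def)
  qed
qed

definition outerplanar :: "'a set \<Rightarrow> 'a set set \<Rightarrow> bool" where
  "outerplanar V E \<longleftrightarrow>
     (\<exists>p \<gamma>. planar_drawing V E p \<gamma> \<and>
            (\<forall>v\<in>V. p v \<in> frontier (outside (drawing_points V E p \<gamma>))))"

definition circ_dist :: "nat \<Rightarrow> nat \<Rightarrow> nat \<Rightarrow> int" where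
  "circ_dist k i j = min \<bar>int i - int j\<bar> (int k - \<bar>int i - int j\<bar>)"

text \<open>
  In a \<open>(k/2, d)\<close>-coloring the fraction is formal notation for the pair \<open>(k, 2)\<close>; the parameter \<open>k\<close>
  below is the numerator, the number of colors.
\<close>

definition circ2_coloring ::
    "'a set \<Rightarrow> 'a set set \<Rightarrow> nat \<Rightarrow> nat \<Rightarrow> ('a \<Rightarrow> nat) \<Rightarrow> bool" where
  "circ2_coloring V E k d f \<longleftrightarrow>
     f ` V \<subseteq> {0..<k} \<and>
     (\<forall>v\<in>V. card {u \<in> V. {u, v} \<in> E \<and> circ_dist k (f u) (f v) \<le> 1} \<le> d)"

definition circ2_colorable :: "'a set \<Rightarrow> 'a set set \<Rightarrow> nat \<Rightarrow> nat \<Rightarrow> bool" where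
  "circ2_colorable V E k d \<longleftrightarrow> (\<exists>f. circ2_coloring V E k d f)"

end

theory Submission
  imports Defs "HOL-Complex_Analysis.Winding_Numbers"
begin

text \<open>
  Opposite colors 0 and 2 suffice: color each vertex by the parity of its breadth-first layer, so
  that only edges inside a layer count against the defect. If a vertex \<open>v\<close> had three neighbors
  \<open>a\<close>, \<open>b\<close>, \<open>c\<close> in its own layer, then joining these through the connected union of the lower
  layers gives three arcs from \<open>v\<close> to a common point \<open>w\<close>, passing through \<open>a\<close>, \<open>b\<close>, \<open>c\<close>
  respectively and otherwise disjoint. In such a theta curve one of the three arcs is not on the
  boundary of the outer region: otherwise a point inside the loop formed by two of the arcs lies
  outside the other two loops, while the winding numbers of the three loops, suitably oriented,
  add up to zero.
\<close>

section \<open>Winding numbers around a theta curve\<close>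

lemma loop_of_arcs:
  assumes "arc c" "arc d" "pathstart d = pathstart c" "pathfinish d = pathfinish c"
    "path_image c \<inter> path_image d = {pathstart c, pathfinish c}"
  shows "simple_path (c +++ reversepath d)"
    and "path_image (c +++ reversepath d) = path_image c \<union> path_image d"
    and "pathfinish (c +++ reversepath d) = pathstart (c +++ reversepath d)"
  using assms by (auto intro!: simple_path_join_loop simp: arc_reversepath path_image_join)

lemma winding_number_join_reversepath:
  assumes "path c" "path d" "pathfinish d = pathfinish c"
    "z \<notin> path_image c" "z \<notin> path_image d"
  shows "winding_number (c +++ reversepath d) z = winding_number c z - winding_number d z"
  using assms by (simp add: winding_number_join winding_number_reversepath)

text \<open>Off the arcs, the winding number of \<open>j12\<close> is that of \<open>j13\<close>
  minus that of \<open>j23\<close>, because the contributions of \<open>c3\<close> cancel. At a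
  point inside \<open>j12\<close> the former is 1 or -1, while the other two vanish. The hypothesis
  \<open>acc\<close> speaks of a closure because it then passes from a whole drawing to any theta
  curve contained in it.\<close>

lemma theta_curve_outside_frontier:
  fixes c1 c2 c3 :: "real \<Rightarrow> complex"
  assumes arcs: "arc c1" "arc c2" "arc c3"
    and starts: "pathstart c1 = v" "pathstart c2 = v" "pathstart c3 = v"
    and fins: "pathfinish c1 = w" "pathfinish c2 = w" "pathfinish c3 = w"
    and meet: "path_image c1 \<inter> path_image c2 = {v, w}" "path_image c1 \<inter> path_image c3 = {v, w}"
      "path_image c2 \<inter> path_image c3 = {v, w}"
    and q1: "q1 \<in> path_image c1 - {v, w}"
    and q2: "q2 \<in> path_image c2 - {v, w}"
    and q3: "q3 \<in> path_image c3 - {v, w}"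
    and acc: "{q1, q2, q3} \<subseteq> closure (outside (path_image c1 \<union> path_image c2 \<union> path_image c3))"
  shows False
proof -
  define j12 where "j12 = c1 +++ reversepath c2"
  define j13 where "j13 = c1 +++ reversepath c3"
  define j23 where "j23 = c2 +++ reversepath c3"
  have sp: "simple_path j12" "simple_path j13" "simple_path j23"
    and im: "path_image j12 = path_image c1 \<union> path_image c2"
      "path_image j13 = path_image c1 \<union> path_image c3"
      "path_image j23 = path_image c2 \<union> path_image c3"
    and loop: "pathfinish j12 = pathstart j12" "pathfinish j13 = pathstart j13" "pathfinish j23 = pathstart j23"
    using loop_of_arcs[of c1 c2] loop_of_arcs[of c1 c3] loop_of_arcs[of c2 c3] assms
    by (auto simp: j12_def j13_def j23_def)
  have inside_outside: "open (inside (path_image j))" "open (outside (path_image j))"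
    "connected (inside (path_image j))" "frontier (inside (path_image j)) = path_image j"
    "inside (path_image j) \<inter> outside (path_image j) = {}"
    "inside (path_image j) \<union> outside (path_image j) = - path_image j"
    "inside (path_image j) \<noteq> {}"
    if "simple_path j" "pathfinish j = pathstart j" for j :: "real \<Rightarrow> complex"
    using Jordan_inside_outside[OF that] by blast+
  \<comment> \<open>Dropping arcs enlarges the outside, so \<open>q\<close> lies in the closure of
    the outside of \<open>j\<close>. The inside of \<open>j\<close> is open and disjoint from that
    outside, hence from its closure.\<close>
  have in_outside: "q \<in> outside (path_image j)"
    if "simple_path j" "pathfinish j = pathstart j" "q \<in> {q1, q2, q3}" "q \<notin> path_image j"
      "path_image j \<subseteq> path_image c1 \<union> path_image c2 \<union> path_image c3" for q j
  proof -
    note io = inside_outside[OF that(1,2)]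
    have "q \<in> closure (outside (path_image j))"
      using acc that(3) closure_mono[OF outside_mono[OF that(5)]] by blast
    then have "q \<notin> inside (path_image j)"
      using io(1,5) open_Int_closure_eq_empty by blast
    then show ?thesis using io(6) that(4) by blast
  qed
  have q3: "q3 \<in> outside (path_image j12)"
    by (rule in_outside) (use sp loop im q3 meet in auto)
  have q2: "q2 \<in> outside (path_image j13)"
    by (rule in_outside) (use sp loop im q2 meet in auto)
  have q1: "q1 \<in> outside (path_image j23)"
    by (rule in_outside) (use sp loop im q1 meet in auto)
  note io12 = inside_outside[OF sp(1) loop(1)]
  \<comment> \<open>Without its ends, \<open>c3\<close> is connected and misses \<open>j12\<close>;
    since \<open>q3\<close> is outside \<open>j12\<close>, all of it is.\<close>
  have c3: "inside (path_image j12) \<inter> path_image c3 = {}"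
  proof (rule ccontr)
    assume ne: "inside (path_image j12) \<inter> path_image c3 \<noteq> {}"
    have "v \<in> path_image j12" "w \<in> path_image j12"
      using meet im by auto
    then have vw: "v \<notin> inside (path_image j12)" "w \<notin> inside (path_image j12)"
      using io12(6) by blast+
    let ?C = "path_image c3 - {pathstart c3, pathfinish c3}"
    have "connected ?C"
      using arcs by (intro connected_simple_path_endless arc_imp_simple_path)
    moreover have "?C \<subseteq> inside (path_image j12) \<union> outside (path_image j12)"
      using io12(6) im meet starts fins by auto
    moreover have "inside (path_image j12) \<inter> ?C \<noteq> {}"
      using ne vw starts fins by auto
    moreover have "q3 \<in> outside (path_image j12) \<inter> ?C"
      using q3 \<open>q3 \<in> path_image c3 - {v, w}\<close> starts fins by auto
    ultimately show False
      using io12(1,2,5) connectedD[of ?C "inside (path_image j12)" "outside (path_image j12)"]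
      by blast
  qed
  \<comment> \<open>The inside of \<open>j12\<close> is connected and misses \<open>j\<close>, so it
    lies on one side of \<open>j\<close>. That side is the outer one, because the outside of
    \<open>j\<close> is an open set around \<open>q\<close>, a boundary point of the inside of
    \<open>j12\<close>.\<close>
  have inside_sub: "inside (path_image j12) \<subseteq> outside (path_image j)"
    if j: "simple_path j" "pathfinish j = pathstart j"
      and sub: "path_image j \<subseteq> path_image j12 \<union> path_image c3"
      and q: "q \<in> path_image j12" "q \<in> outside (path_image j)" for j q
  proof -
    note io = inside_outside[OF j]
    have "q \<in> closure (inside (path_image j12))"
      using q(1) io12(4) by (auto simp: frontier_def)
    then have "inside (path_image j12) \<inter> outside (path_image j) \<noteq> {}"
      using open_Int_closure_eq_empty[OF io(2)] q(2) by blast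
    moreover have "inside (path_image j12) \<subseteq> inside (path_image j) \<union> outside (path_image j)"
      using c3 sub io(6) io12(6) by blast
    ultimately show ?thesis
      using io(1,2,5) io12(3) connectedD[of "inside (path_image j12)" "inside (path_image j)" "outside (path_image j)"]
      by blast
  qed
  obtain z where z: "z \<in> inside (path_image j12)"
    and wn: "winding_number j12 z = 1 \<or> winding_number j12 z = -1"
    using io12(7) simple_closed_path_winding_number_inside[OF sp(1)] by (metis ex_in_conv)
  have "z \<in> outside (path_image j13)"
    using inside_sub[OF sp(2) loop(2) _ _ q2] im z \<open>q2 \<in> path_image c2 - {v, w}\<close> by auto
  then have "winding_number j13 z = 0"
    using winding_number_zero_in_outside sp loop simple_path_imp_path by blast
  moreover have "z \<in> outside (path_image j23)"
    using inside_sub[OF sp(3) loop(3) _ _ q1] im z \<open>q1 \<in> path_image c1 - {v, w}\<close> by auto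
  then have "winding_number j23 z = 0"
    using winding_number_zero_in_outside sp loop simple_path_imp_path by blast
  moreover have "z \<notin> path_image c1" "z \<notin> path_image c2" "z \<notin> path_image c3"
    using z c3 io12(6) im by blast+
  ultimately show False
    using wn arcs fins
    by (auto simp: j12_def j13_def j23_def winding_number_join_reversepath arc_imp_path)
qed

section \<open>Joining three arcs through a connected set\<close>

text \<open>Two start points are joined by an arc \<open>g\<close>, and an arc from the third is run
  up to \<open>g\<close>; its landing point \<open>w\<close> cuts \<open>g\<close> into
  \<open>ga\<close> and \<open>gb\<close>. As \<open>g\<close> may enter and leave \<open>B\<close>
  repeatedly, \<open>ga\<close> may use pieces of \<open>eb\<close>, so only the union of the three
  images is bounded.\<close>

lemma arcs_to_common_point:
  fixes B :: "complex set"
  assumes B: "path_connected B" "closed B"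
    and e: "arc ea" "arc eb" "arc ec"
    and fin: "pathfinish ea \<in> B" "pathfinish eb \<in> B" "pathfinish ec \<in> B"
    and start: "pathstart ea \<notin> B" "pathstart eb \<notin> B" "pathstart ec \<notin> B"
    and meet: "path_image ea \<inter> path_image eb \<subseteq> B" "path_image ea \<inter> path_image ec \<subseteq> B"
      "path_image eb \<inter> path_image ec \<subseteq> B"
  obtains w ga gb gc where "w \<in> B" "arc ga" "arc gb" "arc gc"
    "pathstart ga = pathstart ea" "pathstart gb = pathstart eb" "pathstart gc = pathstart ec"
    "pathfinish ga = w" "pathfinish gb = w" "pathfinish gc = w"
    "path_image ga \<union> path_image gb \<union> path_image gc \<subseteq> B \<union> path_image ea \<union> path_image eb \<union> path_image ec"
    "path_image ga \<inter> path_image gb = {w}" "path_image ga \<inter> path_image gc = {w}"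
    "path_image gb \<inter> path_image gc = {w}"
proof -
  have pc: "path_connected (B \<union> path_image e)" if "arc e" "pathfinish e \<in> B" for e
    using that B by (intro path_connected_Un path_connected_path_image)
      (auto simp: arc_imp_path pathfinish_in_path_image)
  have ends: "pathstart ea \<noteq> pathstart eb"
    using meet start by (metis IntI pathstart_in_path_image subsetD)
  have "path_connected ((B \<union> path_image ea) \<union> (B \<union> path_image eb))"
    by (rule path_connected_Un[OF pc[OF e(1) fin(1)] pc[OF e(2) fin(2)]]) (use fin in auto)
  also have "(B \<union> path_image ea) \<union> (B \<union> path_image eb) = B \<union> path_image ea \<union> path_image eb"
    by blast
  finally obtain g where g: "arc g" "path_image g \<subseteq> B \<union> path_image ea \<union> path_image eb"
      "pathstart g = pathstart ea" "pathfinish g = pathstart eb"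
    unfolding path_connected_arcwise using ends by (meson UnCI pathstart_in_path_image)
  txt \<open>The arc from \<open>ec\<close> is stopped at its first point on \<open>g\<close>. It runs in \<open>B \<union> path_image ec\<close>, which
    forces that point into \<open>B\<close>, away from the ends of \<open>g\<close>.\<close>
  have "path_image g \<inter> B \<noteq> {}"
  proof
    \<comment> \<open>Then \<open>g\<close> would be covered by the closed images of
      \<open>ea\<close> and \<open>eb\<close>, which share no point on \<open>g\<close> and each
      contain an end of \<open>g\<close>, against connectedness.\<close>
    assume "path_image g \<inter> B = {}"
    moreover have "connected (path_image g)" "closed (path_image ea)" "closed (path_image eb)"
      using g(1) e by (auto simp: connected_arc_image closed_arc_image)
    moreover have "path_image g \<subseteq> path_image ea \<union> path_image eb"
      "path_image ea \<inter> path_image eb \<inter> path_image g = {}"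
      using g(2) meet(1) calculation(1) by blast+
    moreover have "path_image ea \<inter> path_image g \<noteq> {}" "path_image eb \<inter> path_image g \<noteq> {}"
      using g(3,4) pathstart_in_path_image pathfinish_in_path_image by (metis IntI empty_iff)+
    ultimately show False
      unfolding connected_closed by blast
  qed
  then obtain q where q: "q \<in> path_image g" "q \<in> B" by blast
  have "pathstart ec \<noteq> q" using q start by auto
  then obtain h where h: "arc h" "path_image h \<subseteq> B \<union> path_image ec" "pathstart h = pathstart ec"
      "pathfinish h = q"
    using pc[OF e(3) fin(3)] q unfolding path_connected_arcwise
    by (metis UnCI pathstart_in_path_image)
  have cg: "pathstart ec \<notin> path_image g"
    using g(2) start(3) meet by (metis IntI UnE pathstart_in_path_image subsetD)
  have closed_g: "closed (path_image g)" using g(1) by (rule closed_arc_image)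
  obtain k where k: "path k" "pathstart k = pathstart ec" "path_image k \<subseteq> path_image h"
      "path_image k - {pathfinish k} \<subseteq> interior (- path_image g)"
      "pathfinish k \<in> frontier (- path_image g)"
    using exists_path_subpath_to_frontier[of h "- path_image g"] h cg q
    by (metis ComplI ComplD arc_imp_path closure_subset subsetD)
  define w where "w = pathfinish k"
  have wg: "w \<in> path_image g"
    using k(5) frontier_subset_closed[OF closed_g] by (auto simp: w_def frontier_complement)
  have kg: "path_image k \<inter> path_image g = {w}"
    using k(4) wg w_def interior_subset by fastforce
  have wB: "w \<in> B"
    using wg g(2) k(3) h(2) meet w_def pathfinish_in_path_image by blast
  have "pathstart ec \<noteq> w" using cg wg by auto
  \<comment> \<open>\<open>k\<close> is only known to be a path, so an arc with the same ends is
    taken within its image.\<close>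
  then obtain gc where gc: "arc gc" "path_image gc \<subseteq> path_image k" "pathstart gc = pathstart ec" "pathfinish gc = w"
    using path_contains_arc[OF k(1,2)] w_def by metis
  obtain u where u: "u \<in> {0..1}" "g u = w" using wg by (auto simp: path_image_def)
  \<comment> \<open>The ends of \<open>g\<close> are not in \<open>B\<close> but \<open>w\<close>
    is, so both pieces cut off at \<open>w\<close> are nondegenerate.\<close>
  have u0: "u \<noteq> 0" "u \<noteq> 1"
    using u wB start g by (auto simp: pathstart_def pathfinish_def)
  have inj: "inj_on g {0..1}" using g(1) by (simp add: arc_def)
  define ga where "ga = subpath 0 u g"
  define gb where "gb = subpath 1 u g"
  have ims: "path_image ga = g ` {0..u}" "path_image gb = g ` {u..1}"
    using u by (auto simp: ga_def gb_def path_image_subpath)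
  have "path_image ga \<inter> path_image gb = g ` ({0..u} \<inter> {u..1})"
    unfolding ims using u by (intro inj_on_image_Int[symmetric, OF inj]) auto
  also have "{0..u} \<inter> {u..1} = {u}" using u by auto
  finally have ab: "path_image ga \<inter> path_image gb = {w}" using u by simp
  have sub: "path_image ga \<subseteq> path_image g" "path_image gb \<subseteq> path_image g"
    unfolding ims using u by (auto simp: path_image_def)
  have wc: "w \<in> path_image gc" using gc by (metis pathfinish_in_path_image)
  show ?thesis
  proof (rule that[of w ga gb gc])
    show "arc ga" "arc gb"
      unfolding ga_def gb_def using u u0 g by (auto intro!: arc_subpath_arc)
    show "pathstart ga = pathstart ea" "pathstart gb = pathstart eb" "pathfinish ga = w" "pathfinish gb = w"
      using g u by (auto simp: ga_def gb_def pathstart_def pathfinish_def subpath_def)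
    show "path_image ga \<inter> path_image gc = {w}" "path_image gb \<inter> path_image gc = {w}"
      using ab sub kg gc wc by blast+
    show "path_image ga \<union> path_image gb \<union> path_image gc \<subseteq> B \<union> path_image ea \<union> path_image eb \<union> path_image ec"
      using sub g gc k h by blast
  qed (use wB gc ab in auto)
qed

section \<open>Breadth-first layers\<close>

text \<open>\<open>r\<close> selects one root in each component and \<open>d\<close> is the distance
  from it, which covers disconnected graphs. An element on no edge is its own root.\<close>

lemma bfs_layering:
  obtains r :: "'a \<Rightarrow> 'a" and d :: "'a \<Rightarrow> nat"
  where "\<And>x y. {x, y} \<in> E \<Longrightarrow> r x = r y"
    and "\<And>x y. {x, y} \<in> E \<Longrightarrow> d y \<le> Suc (d x)"
    and "\<And>x. d x = 0 \<Longrightarrow> r x = x"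
    and "\<And>x n. d x = Suc n \<Longrightarrow> \<exists>y. {x, y} \<in> E \<and> d y = n"
proof -
  define R where "R = {(x, y). {x, y} \<in> E}"
  have "sym R" by (auto simp: R_def sym_def insert_commute)
  then have sym: "(y, x) \<in> R\<^sup>*" if "(x, y) \<in> R\<^sup>*" for x y
    using that by (meson symE sym_rtrancl)
  define r where "r x = (SOME y. (x, y) \<in> R\<^sup>*)" for x
  define d where "d x = (LEAST n. (r x, x) \<in> R ^^ n)" for x
  have "(x, r x) \<in> R\<^sup>*" for x
    unfolding r_def by (rule someI[of _ x]) simp
  then have "\<exists>n. (r x, x) \<in> R ^^ n" for x
    using sym by (simp add: rtrancl_power)
  then have path: "(r x, x) \<in> R ^^ d x" for x
    unfolding d_def by (rule LeastI_ex)
  have d_le: "d x \<le> n" if "(r x, x) \<in> R ^^ n" for x n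
    unfolding d_def using that by (rule Least_le)
  \<comment> \<open>Adjacent elements reach the same elements, so \<open>SOME\<close> is applied to
    the same predicate.\<close>
  have r_eq: "r x = r y" if "(x, y) \<in> R" for x y
  proof -
    have "(x, z) \<in> R\<^sup>* \<longleftrightarrow> (y, z) \<in> R\<^sup>*" for z
      using that sym by (meson r_into_rtrancl rtrancl_trans)
    then show ?thesis by (simp add: r_def)
  qed
  have d_step: "d y \<le> Suc (d x)" if "(x, y) \<in> R" for x y
    using that path[of x] r_eq[OF that] by (intro d_le) auto
  show ?thesis
  proof (rule that[of r d])
    fix x assume "d x = 0"
    then show "r x = x" using path[of x] by simp
  next
    fix x n assume n: "d x = Suc n"
    \<comment> \<open>\<open>y\<close> is the last but one element of a shortest walk from the root;
      \<open>d_step\<close> excludes a smaller layer for it.\<close>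
    then obtain y where y: "(r x, y) \<in> R ^^ n" "(y, x) \<in> R"
      using path[of x] by auto
    then have "d y \<le> n" using r_eq[OF y(2)] by (intro d_le) simp
    with d_step[OF y(2)] n have "d y = n" by simp
    with y show "\<exists>y. {x, y} \<in> E \<and> d y = n"
      by (auto simp: R_def insert_commute)
  qed (use r_eq d_step in \<open>auto simp: R_def\<close>)
qed

section \<open>Edges in a planar drawing\<close>

lemma planar_drawing_oriented_arc:
  assumes "planar_drawing V E p \<gamma>" "{x, y} \<in> E"
  obtains g where "arc g" "path_image g = path_image (\<gamma> {x, y})" "pathstart g = p x" "pathfinish g = p y"
proof -
  have g: "arc (\<gamma> {x, y})" "{pathstart (\<gamma> {x, y}), pathfinish (\<gamma> {x, y})} = {p x, p y}"
    using assms by (auto simp: planar_drawing_def)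
  then consider "pathstart (\<gamma> {x, y}) = p x" "pathfinish (\<gamma> {x, y}) = p y"
    | "pathstart (\<gamma> {x, y}) = p y" "pathfinish (\<gamma> {x, y}) = p x"
    by (auto simp: doubleton_eq_iff)
  then show ?thesis
  proof cases
    case 1
    then show ?thesis using that g by blast
  next
    case 2
    then show ?thesis using that[of "reversepath (\<gamma> {x, y})"] g by (simp add: arc_reversepath)
  qed
qed

text \<open>Common points of two arcs are vertices, and an arc contains only the vertices of its own
  edge; injectivity of \<open>p\<close> then moves the intersection under the image.\<close>

lemma planar_drawing_edges_meet:
  assumes G: "simple_graph V E" and dr: "planar_drawing V E p \<gamma>"
    and e: "e \<in> E" "e' \<in> E" "e \<noteq> e'"
  shows "path_image (\<gamma> e) \<inter> path_image (\<gamma> e') \<subseteq> p ` (e \<inter> e')"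
proof -
  have "path_image (\<gamma> e) \<inter> path_image (\<gamma> e') \<subseteq> p ` e \<inter> p ` e'"
  proof -
    have "path_image (\<gamma> e) \<inter> path_image (\<gamma> e') \<subseteq> p ` V"
      "path_image (\<gamma> e) \<inter> p ` V = p ` e" "path_image (\<gamma> e') \<inter> p ` V = p ` e'"
      using dr e by (simp_all add: planar_drawing_def)
    then show ?thesis by blast
  qed
  also have "\<dots> = p ` (e \<inter> e')"
    using G dr e by (intro inj_on_image_Int[symmetric]) (auto simp: planar_drawing_def simple_graph_def)
  finally show ?thesis .
qed

lemma planar_drawing_edge_vertex:
  assumes "simple_graph V E" "planar_drawing V E p \<gamma>" "e \<in> E" "x \<in> V" "p x \<in> path_image (\<gamma> e)"
  shows "x \<in> e"
proof -
  have "p x \<in> p ` e" using assms unfolding planar_drawing_def by blast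
  then show ?thesis
    using assms inj_on_image_mem_iff[of p V x e] by (auto simp: planar_drawing_def simple_graph_def)
qed

section \<open>Neighbors within one layer\<close>

text \<open>Three elements of \<open>S\<close> would yield a theta curve with ends
  \<open>p v\<close> and \<open>w\<close>. In the proof, \<open>B\<close> is the drawn part of the
  lower layers, \<open>f x\<close> the edge from \<open>v\<close> to \<open>x\<close>,
  \<open>e x\<close> the edge from \<open>x\<close> down to a parent \<open>q x\<close>, and
  \<open>h x\<close> the branch through \<open>p x\<close>.\<close>

lemma outerplanar_layer_degree:
  assumes G: "simple_graph V E" and dr: "planar_drawing V E p \<gamma>"
    and outer: "\<forall>v\<in>V. p v \<in> frontier (outside (drawing_points V E p \<gamma>))"
    and r_edge: "\<And>x y. {x, y} \<in> E \<Longrightarrow> r x = r y"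
    and d0: "\<And>x. d x = 0 \<Longrightarrow> r x = x"
    and parent: "\<And>x n. d x = Suc n \<Longrightarrow> \<exists>y. {x, y} \<in> E \<and> d y = n"
    and v: "d v = Suc n"
    and S: "S \<subseteq> {u. {u, v} \<in> E \<and> d u = Suc n}"
  shows "card S \<le> 2"
proof (rule ccontr)
  assume "\<not> card S \<le> 2"
  then obtain N where N: "N \<subseteq> S" "card N = 3"
    using obtain_subset_with_card_n[of 3 S] by auto
  then obtain a b c where abc: "N = {a, b, c}" "a \<noteq> b" "a \<noteq> c" "b \<noteq> c"
    by (auto simp: card_3_iff)
  have N_edge: "{v, x} \<in> E" "d x = Suc n" if "x \<in> N" for x
    using that N S by (auto simp: insert_commute)
  have edge_V: "x \<in> V" "y \<in> V" "x \<noteq> y" if "{x, y} \<in> E" for x y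
    using that G by (auto simp: simple_graph_def card_insert_if)
  have N_V: "x \<in> V" "x \<noteq> v" if "x \<in> N" for x
    using edge_V N_edge that by blast+
  have finE: "finite E"
    using G unfolding simple_graph_def by (meson PowI finite_Pow_iff finite_subset subsetI)
  have inj: "p x = p y \<longleftrightarrow> x = y" if "x \<in> V" "y \<in> V" for x y
    using dr that by (auto simp: planar_drawing_def inj_on_def)
  note meet = planar_drawing_edges_meet[OF G dr]
  note on_edge = planar_drawing_edge_vertex[OF G dr]

  \<comment> \<open>Restricting to the root of \<open>v\<close> keeps \<open>B\<close> connected;
    the neighbors of \<open>v\<close> and their parents share that root.\<close>
  define U where "U = {x \<in> V. r x = r v \<and> d x \<le> n}"
  define F where "F = {e \<in> E. e \<subseteq> U}"
  define B where "B = drawing_points U F p \<gamma>"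
  have B_eq: "B = p ` U \<union> (\<Union>e\<in>F. path_image (\<gamma> e))"
    by (simp add: B_def drawing_points_def)
  have F_path: "path (\<gamma> e)" if "e \<in> F" for e
    using that dr by (auto simp: F_def planar_drawing_def arc_imp_path)
  have "closed B"
    unfolding B_eq using finE G F_path
    by (intro closed_Un closed_UN finite_imp_closed)
      (auto simp: F_def U_def simple_graph_def closed_path_image)
  \<comment> \<open>Induction on the layer: an edge to a parent has both ends in \<open>U\<close>,
    so it is drawn in \<open>B\<close>, and the descent stops at the root.\<close>
  have to_root: "path_component B (p x) (p (r v))" if "x \<in> U" for x
    using that
  proof (induction "d x" arbitrary: x)
    case 0
    then have "x = r v" using d0[of x] by (simp add: U_def)
    with 0 show ?case by (auto simp: path_component_refl_eq B_eq)
  next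
    case (Suc k)
    obtain y where y: "{x, y} \<in> E" "d y = k" using parent Suc(2) by metis
    have "y \<in> U" using Suc(2,3) y r_edge[OF y(1)] edge_V[OF y(1)] by (auto simp: U_def)
    obtain g where g: "arc g" "path_image g = path_image (\<gamma> {x, y})" "pathstart g = p x" "pathfinish g = p y"
      using planar_drawing_oriented_arc[OF dr y(1)] by metis
    have "path_image g \<subseteq> B"
      using g(2) y Suc(3) \<open>y \<in> U\<close> by (auto simp: B_eq F_def)
    then have "path_component B (p x) (p y)"
      using g unfolding path_component_def by (metis arc_imp_path)
    then show ?case using Suc(1)[of y] y \<open>y \<in> U\<close> path_component_trans by metis
  qed
  have "path_connected B"
  proof -
    have "path_component B z (p (r v))" if "z \<in> B" for z
    proof (cases "z \<in> p ` U")
      case False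
      with that obtain e where e: "e \<in> F" "z \<in> path_image (\<gamma> e)" by (auto simp: B_eq)
      then have "p ` e = {pathstart (\<gamma> e), pathfinish (\<gamma> e)}"
        using dr by (auto simp: F_def planar_drawing_def)
      then obtain x where x: "x \<in> e" "p x = pathstart (\<gamma> e)" by (metis image_iff insertI1)
      have "path_component (path_image (\<gamma> e)) (p x) z"
        using path_component_path_image_pathstart[OF F_path[OF e(1)] e(2)] x by simp
      then have "path_component B (p x) z"
        using e(1) path_component_of_subset[of "path_image (\<gamma> e)" B] by (auto simp: B_eq)
      moreover have "x \<in> U" using x e by (auto simp: F_def)
      ultimately show ?thesis using to_root path_component_sym path_component_trans by metis
    qed (use to_root in blast)
    then show ?thesis
      unfolding path_connected_component using path_component_sym path_component_trans by metis
  qed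

  have "\<exists>y. {x, y} \<in> E \<and> d y = n" if "x \<in> N" for x
    using parent N_edge that by blast
  then obtain q where q: "\<And>x. x \<in> N \<Longrightarrow> {x, q x} \<in> E \<and> d (q x) = n" by metis
  have "\<exists>g. arc g \<and> path_image g = path_image (\<gamma> {x, q x}) \<and> pathstart g = p x \<and> pathfinish g = p (q x)"
    if "x \<in> N" for x
    using planar_drawing_oriented_arc[OF dr] q that by metis
  then obtain e where e: "\<And>x. x \<in> N \<Longrightarrow> arc (e x) \<and> path_image (e x) = path_image (\<gamma> {x, q x}) \<and>
      pathstart (e x) = p x \<and> pathfinish (e x) = p (q x)" by metis
  have "\<exists>g. arc g \<and> path_image g = path_image (\<gamma> {v, x}) \<and> pathstart g = p v \<and> pathfinish g = p x"
    if "x \<in> N" for x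
    using planar_drawing_oriented_arc[OF dr] N_edge that by metis
  then obtain f where f: "\<And>x. x \<in> N \<Longrightarrow> arc (f x) \<and> path_image (f x) = path_image (\<gamma> {v, x}) \<and>
      pathstart (f x) = p v \<and> pathfinish (f x) = p x" by metis

  have qU: "q x \<in> U" if "x \<in> N" for x
    using q[OF that] edge_V[of x "q x"] r_edge[of x "q x"] N_edge[OF that] r_edge[of v x]
    by (simp add: U_def)
  have out_B: "p x \<notin> B" if x: "x \<in> V" "d x = Suc n" for x
  proof
    assume "p x \<in> B"
    then consider y where "y \<in> U" "p x = p y" | e where "e \<in> F" "p x \<in> path_image (\<gamma> e)"
      by (auto simp: B_eq)
    then have "x \<in> U"
    proof cases
      case 1
      then show ?thesis using inj[of x y] x by (simp add: U_def)
    next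
      case 2
      then show ?thesis using on_edge[of e x] x by (auto simp: F_def)
    qed
    then show False using x by (simp add: U_def)
  qed
  have e_meet: "path_image (e x) \<inter> path_image (e y) \<subseteq> B" if "x \<in> N" "y \<in> N" "x \<noteq> y" for x y
  proof -
    \<comment> \<open>The layers leave a shared parent as the only possible common end, and that
      parent is drawn in \<open>B\<close>.\<close>
    have "x \<noteq> q y" "y \<noteq> q x" using q that N_edge by (metis n_not_Suc_n)+
    then have "{x, q x} \<inter> {y, q y} \<subseteq> U" "{x, q x} \<noteq> {y, q y}"
      using that qU by auto
    then show ?thesis
      using meet[of "{x, q x}" "{y, q y}"] q e that by (fastforce simp: B_eq)
  qed
  have f_e: "path_image (f x) \<inter> path_image (e y) \<subseteq> {p x}" if "x \<in> N" "y \<in> N" for x y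
  proof -
    \<comment> \<open>Only \<open>q y\<close> lies in layer \<open>n\<close>, so the two edges can
      share an end only if \<open>x = y\<close>.\<close>
    have "v \<noteq> q y" "x \<noteq> q y" "v \<noteq> y" using q that N_edge v N_V by (metis n_not_Suc_n)+
    then have "{v, x} \<inter> {y, q y} \<subseteq> {x}" "{v, x} \<noteq> {y, q y}" by auto
    then show ?thesis
      using meet[of "{v, x}" "{y, q y}"] q[of y] N_edge[of x] e[of y] f[of x] that by auto
  qed
  have f_B: "path_image (f x) \<inter> B = {}" if x: "x \<in> N" for x
  proof -
    \<comment> \<open>Both ends of this edge lie above layer \<open>n\<close>, so its arc cannot
      touch any vertex or edge drawn in \<open>B\<close>.\<close>
    have disj: "{v, x} \<inter> U = {}" using v N_edge[OF x] by (auto simp: U_def)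
    have "z \<notin> path_image (f x)" if z: "z \<in> path_image (\<gamma> e')" and "e' \<in> F" for z e'
    proof -
      have "{v, x} \<noteq> e'" "{v, x} \<inter> e' = {}" "e' \<in> E" using disj that(2) by (auto simp: F_def)
      then show ?thesis using meet[of "{v, x}" e'] z f[OF x] N_edge[OF x] by auto
    qed
    moreover have "p y \<notin> path_image (f x)" if "y \<in> U" for y
    proof
      assume "p y \<in> path_image (f x)"
      then have "y \<in> {v, x}" using on_edge[of "{v, x}" y] f[OF x] N_edge[OF x] that by (auto simp: U_def)
      then show False using disj that by auto
    qed
    ultimately show ?thesis by (auto simp: B_eq)
  qed
  have f_f: "path_image (f x) \<inter> path_image (f y) = {p v}" if "x \<in> N" "y \<in> N" "x \<noteq> y" for x y
  proof -
    have "{v, x} \<inter> {v, y} \<subseteq> {v}" "{v, x} \<noteq> {v, y}"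
      using that N_V by (auto simp: doubleton_eq_iff)
    then have "path_image (f x) \<inter> path_image (f y) \<subseteq> {p v}"
      using meet[of "{v, x}" "{v, y}"] N_edge f that by auto
    moreover have "p v \<in> path_image (f x)" "p v \<in> path_image (f y)"
      using f that by (metis pathstart_in_path_image)+
    ultimately show ?thesis by blast
  qed

  have abc_N: "a \<in> N" "b \<in> N" "c \<in> N" using abc by auto
  obtain w ga gb gc where w: "w \<in> B" and g: "arc ga" "arc gb" "arc gc"
    "pathstart ga = p a" "pathstart gb = p b" "pathstart gc = p c"
    "pathfinish ga = w" "pathfinish gb = w" "pathfinish gc = w"
    "path_image ga \<union> path_image gb \<union> path_image gc
       \<subseteq> B \<union> path_image (e a) \<union> path_image (e b) \<union> path_image (e c)"
    and g_meet: "path_image ga \<inter> path_image gb = {w}" "path_image ga \<inter> path_image gc = {w}"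
    "path_image gb \<inter> path_image gc = {w}"
  proof (rule arcs_to_common_point[OF \<open>path_connected B\<close> \<open>closed B\<close>, of "e a" "e b" "e c"])
    show "pathfinish (e a) \<in> B" "pathfinish (e b) \<in> B" "pathfinish (e c) \<in> B"
      using e qU abc_N by (auto simp: B_eq)
    show "pathstart (e a) \<notin> B" "pathstart (e b) \<notin> B" "pathstart (e c) \<notin> B"
      using e out_B N_edge N_V abc_N by auto
  qed (use e e_meet abc abc_N in auto)
  \<comment> \<open>The arcs \<open>ga\<close>, \<open>gb\<close>, \<open>gc\<close> stay in
    \<open>B\<close> and the arcs \<open>e y\<close>; \<open>f x\<close> misses \<open>B\<close> and
    meets the arcs \<open>e y\<close> at most in \<open>p x\<close>.\<close>
  have f_g: "path_image (f x) \<inter> (path_image ga \<union> path_image gb \<union> path_image gc) \<subseteq> {p x}" if "x \<in> N" for x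
    using f_B[OF that] f_e[OF that] abc_N g(10) by blast
  have w_N: "p x \<noteq> w" if "x \<in> N" for x
    using w out_B N_edge N_V that by metis
  have mem: "p a \<in> path_image ga" "p b \<in> path_image gb" "p c \<in> path_image gc"
    "w \<in> path_image ga" "w \<in> path_image gb" "w \<in> path_image gc"
    using g by (metis pathstart_in_path_image pathfinish_in_path_image)+
  define h where "h x = f x +++ (if x = a then ga else if x = b then gb else gc)" for x
  have h: "arc (h x)" "pathstart (h x) = p v" "pathfinish (h x) = w" "p x \<in> path_image (h x)" if "x \<in> N" for x
  proof -
    have "arc (f x +++ g')" if "arc g'" "pathstart g' = p x"
      "path_image g' \<subseteq> path_image ga \<union> path_image gb \<union> path_image gc" for g'
      using that f[OF \<open>x \<in> N\<close>] f_g[OF \<open>x \<in> N\<close>] by (intro arc_join) auto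
    then show "arc (h x)" using \<open>x \<in> N\<close> abc g by (auto simp: h_def)
  qed (use that abc g f mem in \<open>auto simp: h_def path_image_join\<close>)
  have h_im: "path_image (h a) = path_image (f a) \<union> path_image ga"
    "path_image (h b) = path_image (f b) \<union> path_image gb"
    "path_image (h c) = path_image (f c) \<union> path_image gc"
    using abc f abc_N g by (auto simp: h_def path_image_join)
  \<comment> \<open>\<open>p a\<close> lies on \<open>ga\<close>, which meets the other two arcs
    only in \<open>w\<close>, and \<open>p a\<close> differs from \<open>w\<close>; likewise for
    \<open>b\<close> and \<open>c\<close>. This removes the one point that \<open>f_g\<close> still
    allows.\<close>
  have off: "p a \<notin> path_image gb" "p a \<notin> path_image gc" "p b \<notin> path_image ga"
    "p b \<notin> path_image gc" "p c \<notin> path_image ga" "p c \<notin> path_image gb"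
    using mem g_meet w_N[OF abc_N(1)] w_N[OF abc_N(2)] w_N[OF abc_N(3)] by blast+
  have f_g_off: "path_image (f a) \<inter> path_image gb = {}" "path_image (f a) \<inter> path_image gc = {}"
    "path_image (f b) \<inter> path_image ga = {}" "path_image (f b) \<inter> path_image gc = {}"
    "path_image (f c) \<inter> path_image ga = {}" "path_image (f c) \<inter> path_image gb = {}"
    using off f_g[OF abc_N(1)] f_g[OF abc_N(2)] f_g[OF abc_N(3)] by blast+
  have h_meet: "path_image (h a) \<inter> path_image (h b) = {p v, w}"
    "path_image (h a) \<inter> path_image (h c) = {p v, w}"
    "path_image (h b) \<inter> path_image (h c) = {p v, w}"
    \<comment> \<open>Of the four intersections, the two initial edges give \<open>p v\<close>, the
      two final arcs give \<open>w\<close>, and the mixed pairs give nothing.\<close>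
    unfolding h_im Int_Un_distrib Int_Un_distrib2
    using f_f[OF abc_N(1,2) abc(2)] f_f[OF abc_N(1,3) abc(3)] f_f[OF abc_N(2,3) abc(4)] f_g_off g_meet
    by (simp_all add: Int_commute insert_commute)
  have "B \<subseteq> drawing_points V E p \<gamma>"
    by (auto simp: B_eq drawing_points_def U_def F_def)
  moreover have "path_image (f x) \<subseteq> drawing_points V E p \<gamma>" "path_image (e x) \<subseteq> drawing_points V E p \<gamma>"
    if "x \<in> N" for x
    using f e that N_edge q by (auto simp: drawing_points_def)
  ultimately have "path_image (h a) \<union> path_image (h b) \<union> path_image (h c) \<subseteq> drawing_points V E p \<gamma>"
    unfolding h_im using abc_N g(10) by blast
  \<comment> \<open>The theta curve is part of the drawing, so its outside is at least as large, and
    \<open>p a\<close>, \<open>p b\<close>, \<open>p c\<close> remain in the closure.\<close>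
  then have "closure (outside (drawing_points V E p \<gamma>))
      \<subseteq> closure (outside (path_image (h a) \<union> path_image (h b) \<union> path_image (h c)))"
    by (intro closure_mono outside_mono)
  moreover have "p x \<in> closure (outside (drawing_points V E p \<gamma>))" if "x \<in> N" for x
    using outer N_V[OF that] by (auto simp: frontier_def)
  ultimately have "{p a, p b, p c} \<subseteq> closure (outside (path_image (h a) \<union> path_image (h b) \<union> path_image (h c)))"
    using abc_N by blast
  moreover have "p x \<in> path_image (h x) - {p v, w}" if "x \<in> N" for x
    using h(4)[OF that] w_N[OF that] inj[of x v] N_V[OF that] edge_V[OF N_edge(1)[OF that]] by simp
  ultimately show False
    using theta_curve_outside_frontier[of "h a" "h b" "h c" "p v" w "p a" "p b" "p c"]
      h h_meet abc_N by blast
qed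

section \<open>The coloring by two opposite colors\<close>

theorem theorem5p7:
  fixes V :: "'a set" and E :: "'a set set"
  assumes "simple_graph V E" and "outerplanar V E"
  shows "circ2_colorable V E 4 2"
proof -
  obtain p \<gamma> where dr: "planar_drawing V E p \<gamma>"
    and outer: "\<forall>v\<in>V. p v \<in> frontier (outside (drawing_points V E p \<gamma>))"
    using assms(2) by (auto simp: outerplanar_def)
  obtain r :: "'a \<Rightarrow> 'a" and d :: "'a \<Rightarrow> nat"
    where r_edge: "\<And>x y. {x, y} \<in> E \<Longrightarrow> r x = r y"
      and d_edge: "\<And>x y. {x, y} \<in> E \<Longrightarrow> d y \<le> Suc (d x)"
      and d0: "\<And>x. d x = 0 \<Longrightarrow> r x = x"
      and parent: "\<And>x n. d x = Suc n \<Longrightarrow> \<exists>y. {x, y} \<in> E \<and> d y = n"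
    by (rule bfs_layering[of E]) (rule that)
  define f where "f x = 2 * (d x mod 2)" for x
  have "card {u \<in> V. {u, v} \<in> E \<and> circ_dist 4 (f u) (f v) \<le> 1} \<le> 2" for v
  proof -
    let ?S = "{u \<in> V. {u, v} \<in> E \<and> circ_dist 4 (f u) (f v) \<le> 1}"
    \<comment> \<open>The colors 0 and 2 are at circular distance 2, so a conflict forces equal
      parity; the layers of adjacent vertices differ by at most 1, so equal parity means equal
      layers.\<close>
    have same: "d u = d v" if "u \<in> ?S" for u
    proof -
      have "d u mod 2 = d v mod 2"
        using that mod_less_divisor[of 2 "d u"] mod_less_divisor[of 2 "d v"]
        by (auto simp: f_def circ_dist_def less_2_cases_iff)
      moreover have "d u \<le> Suc (d v)" "d v \<le> Suc (d u)"
        using that d_edge[of u v] d_edge[of v u] by (auto simp: insert_commute)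
      ultimately show ?thesis by presburger
    qed
    show ?thesis
    proof (cases "d v")
      case 0
      \<comment> \<open>Adjacent vertices in layer 0 are both the root of their common component,
        hence coincide.\<close>
      have "u = v" if "u \<in> ?S" for u
        using that same[OF that] 0 d0[of u] d0[of v] r_edge[of u v] by simp
      then have "?S \<subseteq> {v}" by blast
      then have "card ?S \<le> card {v}" by (intro card_mono) auto
      then show ?thesis by simp
    next
      case (Suc n)
      have "?S \<subseteq> {u. {u, v} \<in> E \<and> d u = Suc n}"
        using same Suc by auto
      then show ?thesis
        using outerplanar_layer_degree[OF assms(1) dr outer r_edge d0 parent Suc] by blast
    qed
  qed
  moreover have "f ` V \<subseteq> {0..<4}" by (auto simp: f_def)
  ultimately show ?thesis
    by (auto simp: circ2_colorable_def circ2_coloring_def)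
qed

end
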